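(* Let assumptions (A1)-(A4) of the context hold. Then for all $\epsilon\in(0,1)$, the sets $\Omega_0^\epsilon,\dots,\Omega_{N-1}^\epsilon$ are finitely determined.
   Context: Setting. Let $N\ge 1$ be an integer. Consider the discrete-time $N$-periodic system $x(t+1)=A(t)x(t)$, $y(t)=C(t)x(t)$, $t\in\mathbb{Z}^+=\{0,1,2,\dots\}$, with $x(t)\in\mathbb{R}^n$, $y(t)\in\mathbb{R}^p$, real matrices $A(t)\in\mathbb{R}^{n\times n}$, $C(t)\in\mathbb{R}^{p\times n}$, $A(t+N)=A(t)$, $C(t+N)=C(t)$. Write $A_k=A(k)$, $C_k=C(k)$ for $k=0,\dots,N-1$. The output is required to satisfy $y(t)\in\mathbb{Y}_{t \bmod N}$. Vector inequalities are componentwise, and $\mathbf{1}$ is the all-ones vector of appropriate dimension. Lifted matrices: $\Phi=A_{N-1}\cdots A_1A_0$; $C$ is the block column with blocks $C_0,\ C_1A_0,\ \dots,\ C_{N-1}A_{N-2}\cdots A_0$; $S=\mathrm{blockdiag}(S_0,\dots,S_{N-1})$. Assumptions. (A1) There is $d\in\mathbb{Z}^+$ such that for all $k$, $A_k=\begin{bmatrix}A_{k,s}&A_{k,c}\\ \mathbf{0}&I_d\end{bmatrix}$, $C_k=[C_{k,s}\ \ C_{k,c}]$. Consequently $\Phi=\begin{bmatrix}\Phi_s&\Phi_c\\ \mathbf{0}&I_d\end{bmatrix}$, $C=[C_s\ \ C_c]$, partitioned consistently. (A2) All eigenvalues of $\Phi_s$ lie in the open unit disk. (A3) The pair $(C,\Phi)$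 is observable. (A4) For each $k$, $\mathbb{Y}_k=\{y\in\mathbb{R}^p: S_ky\le\mathbf{1}\}$ is compact, where $S_k\in\mathbb{R}^{q_k\times p}$. Definitions. For $k\in\{0,\dots,N-1\}$ and $j\ge k$, let $\Omega_k^j=\{x_0\in\mathbb{R}^n:$ the solution with $x(k)=x_0$ satisfies $y(t)\in\mathbb{Y}_{t \bmod N}$ for all $k\le t\le j\}$, and $\Omega_k=\bigcap_{j\ge k}\Omega_k^j$. Let $\Gamma=[\mathbf{0}\quad C_s(I-\Phi_s)^{-1}\Phi_c+C_c]$ (zero block with $n-d$ columns), $\Omega_{ss}^\epsilon=\{x_0\in\mathbb{R}^n: S\Gamma x_0\le(1-\epsilon)\mathbf{1}\}$, and $\Omega_k^\epsilon=\Omega_{ss}^\epsilon\cap\Omega_k$. The set $\Omega_k^\epsilon$ is finitely determined if there is a finite $j^*$ such that $\Omega_{ss}^\epsilon\cap\Omega_k^j=\Omega_{ss}^\epsilon\cap\Omega_k^{j^*}$ for all $j\ge j^*$ (so that $\Omega_k^\epsilon=\Omega_{ss}^\epsilon\cap\Omega_k^{j^*}$). *)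

theory Defs
  imports
    "HOL-Analysis.Abstract_Euclidean_Space"
    "Jordan_Normal_Form.Char_Poly"
    "Jordan_Normal_Form.Gauss_Jordan_Elimination"
begin

text \<open>
  Vectors in \<open>\<real>\<^sup>m\<close> and matrices are those of \<open>Jordan_Normal_Form\<close>, with explicit carriers, because
  the blocks \<open>n - d\<close>, \<open>d\<close> may be empty and the sizes \<open>q k\<close> of the constraint matrices depend on
  \<open>k\<close>. The order on vectors from that library is componentwise between vectors of equal dimension.
\<close>

definition ones_vec :: "nat \<Rightarrow> real Matrix.vec" where
  "ones_vec m = Matrix.vec m (\<lambda>_. 1)"

definition append_cols :: "real mat \<Rightarrow> real mat \<Rightarrow> real mat" where
  "append_cols X Y = four_block_mat X Y (0\<^sub>m 0 (dim_col X)) (0\<^sub>m 0 (dim_col Y))"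

text \<open>The carrier has no topology of its own; a vector in \<open>\<real>\<^sup>p\<close>, padded with zeros, is a point of the
  topological space \<open>Euclidean_space p\<close>.\<close>

definition padded :: "real Matrix.vec \<Rightarrow> nat \<Rightarrow> real" where
  "padded v = (\<lambda>i. if i < dim_vec v then vec_index v i else 0)"

definition compact_vecs :: "nat \<Rightarrow> real Matrix.vec set \<Rightarrow> bool" where
  "compact_vecs p Y \<longleftrightarrow> Y \<subseteq> carrier_vec p \<and> compactin (Euclidean_space p) (padded ` Y)"

text \<open>Observability of the pair \<open>(C, \<Phi>)\<close>: finitely many outputs of \<open>z(i+1) = \<Phi> z(i)\<close>,
  \<open>w(i) = C z(i)\<close> determine the initial state.\<close>

definition observable_pair :: "real mat \<Rightarrow> real mat \<Rightarrow> bool" where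
  "observable_pair C \<Phi> \<longleftrightarrow>
     (\<exists>T::nat. \<forall>z \<in> carrier_vec (dim_col \<Phi>). \<forall>z' \<in> carrier_vec (dim_col \<Phi>).
        (\<forall>i<T. C *\<^sub>v (\<Phi> ^\<^sub>m i *\<^sub>v z) = C *\<^sub>v (\<Phi> ^\<^sub>m i *\<^sub>v z')) \<longrightarrow> z = z')"


subsection \<open>Lifted matrices\<close>

text \<open>\<open>transition n A t = A (t - 1) * \<dots> * A 1 * A 0\<close>\<close>

primrec transition :: "nat \<Rightarrow> (nat \<Rightarrow> real mat) \<Rightarrow> nat \<Rightarrow> real mat" where
  "transition n A 0 = 1\<^sub>m n"
| "transition n A (Suc t) = A t * transition n A t"

definition Phi :: "nat \<Rightarrow> nat \<Rightarrow> (nat \<Rightarrow> real mat) \<Rightarrow> real mat" where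
  "Phi N n A = transition n A N"

definition lifted_C :: "nat \<Rightarrow> nat \<Rightarrow> (nat \<Rightarrow> real mat) \<Rightarrow> (nat \<Rightarrow> real mat) \<Rightarrow> real mat" where
  "lifted_C N n A C = foldr (@\<^sub>r) (map (\<lambda>k. C k * transition n A k) [0..<N]) (0\<^sub>m 0 n)"

definition lifted_S :: "nat \<Rightarrow> (nat \<Rightarrow> real mat) \<Rightarrow> real mat" where
  "lifted_S N S = diag_block_mat (map S [0..<N])"

definition Phi_s :: "nat \<Rightarrow> nat \<Rightarrow> nat \<Rightarrow> (nat \<Rightarrow> real mat) \<Rightarrow> real mat" where
  "Phi_s N n d A = (case split_block (Phi N n A) (n - d) (n - d) of (M1, M2, M3, M4) \<Rightarrow> M1)"

definition Phi_c :: "nat \<Rightarrow> nat \<Rightarrow> nat \<Rightarrow> (nat \<Rightarrow> real mat) \<Rightarrow> real mat" where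
  "Phi_c N n d A = (case split_block (Phi N n A) (n - d) (n - d) of (M1, M2, M3, M4) \<Rightarrow> M2)"

text \<open>All rows of the lifted output matrix lie in the upper blocks of the split.\<close>

definition C_s :: "nat \<Rightarrow> nat \<Rightarrow> nat \<Rightarrow> (nat \<Rightarrow> real mat) \<Rightarrow> (nat \<Rightarrow> real mat) \<Rightarrow> real mat" where
  "C_s N n d A C = (let L = lifted_C N n A C in
     case split_block L (dim_row L) (n - d) of (M1, M2, M3, M4) \<Rightarrow> M1)"

definition C_c :: "nat \<Rightarrow> nat \<Rightarrow> nat \<Rightarrow> (nat \<Rightarrow> real mat) \<Rightarrow> (nat \<Rightarrow> real mat) \<Rightarrow> real mat" where
  "C_c N n d A C = (let L = lifted_C N n A C in
     case split_block L (dim_row L) (n - d) of (M1, M2, M3, M4) \<Rightarrow> M2)"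

text \<open>The inverse below exists whenever 1 is not an eigenvalue of \<open>\<Phi>\<^sub>s\<close>.\<close>

definition Gamma :: "nat \<Rightarrow> nat \<Rightarrow> nat \<Rightarrow> (nat \<Rightarrow> real mat) \<Rightarrow> (nat \<Rightarrow> real mat) \<Rightarrow> real mat" where
  "Gamma N n d A C =
     append_cols (0\<^sub>m (dim_row (lifted_C N n A C)) (n - d))
       (C_s N n d A C * the (mat_inverse (1\<^sub>m (n - d) - Phi_s N n d A)) * Phi_c N n d A
          + C_c N n d A C)"


subsection \<open>Constraint-admissible sets\<close>

definition output_set :: "nat \<Rightarrow> (nat \<Rightarrow> real mat) \<Rightarrow> nat \<Rightarrow> real Matrix.vec set" where
  "output_set p S k = {y \<in> carrier_vec p. S k *\<^sub>v y \<le> ones_vec (dim_row (S k))}"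

text \<open>\<open>solution A k x0 i\<close> is the state \<open>x(k + i)\<close> of the solution with \<open>x(k) = x0\<close>.\<close>

primrec solution :: "(nat \<Rightarrow> real mat) \<Rightarrow> nat \<Rightarrow> real Matrix.vec \<Rightarrow> nat \<Rightarrow> real Matrix.vec" where
  "solution A k x0 0 = x0"
| "solution A k x0 (Suc i) = A (k + i) *\<^sub>v solution A k x0 i"

definition Omega_upto ::
  "nat \<Rightarrow> nat \<Rightarrow> nat \<Rightarrow> (nat \<Rightarrow> real mat) \<Rightarrow> (nat \<Rightarrow> real mat) \<Rightarrow> (nat \<Rightarrow> real mat) \<Rightarrow>
   nat \<Rightarrow> nat \<Rightarrow> real Matrix.vec set" where
  "Omega_upto N n p A C S k j =
     {x0 \<in> carrier_vec n.
        \<forall>t. k \<le> t \<and> t \<le> j \<longrightarrow> C t *\<^sub>v solution A k x0 (t - k) \<in> output_set p S (t mod N)}"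

definition Omega ::
  "nat \<Rightarrow> nat \<Rightarrow> nat \<Rightarrow> (nat \<Rightarrow> real mat) \<Rightarrow> (nat \<Rightarrow> real mat) \<Rightarrow> (nat \<Rightarrow> real mat) \<Rightarrow>
   nat \<Rightarrow> real Matrix.vec set" where
  "Omega N n p A C S k = (\<Inter>j\<in>{k..}. Omega_upto N n p A C S k j)"

definition Omega_ss ::
  "nat \<Rightarrow> nat \<Rightarrow> nat \<Rightarrow> (nat \<Rightarrow> real mat) \<Rightarrow> (nat \<Rightarrow> real mat) \<Rightarrow> (nat \<Rightarrow> real mat) \<Rightarrow>
   real \<Rightarrow> real Matrix.vec set" where
  "Omega_ss N n d A C S \<epsilon> =
     {x0 \<in> carrier_vec n.
        lifted_S N S * Gamma N n d A C *\<^sub>v x0 \<le> (1 - \<epsilon>) \<cdot>\<^sub>v ones_vec (dim_row (lifted_S N S))}"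

definition Omega_eps ::
  "nat \<Rightarrow> nat \<Rightarrow> nat \<Rightarrow> nat \<Rightarrow> (nat \<Rightarrow> real mat) \<Rightarrow> (nat \<Rightarrow> real mat) \<Rightarrow> (nat \<Rightarrow> real mat) \<Rightarrow>
   real \<Rightarrow> nat \<Rightarrow> real Matrix.vec set" where
  "Omega_eps N n p d A C S \<epsilon> k = Omega_ss N n d A C S \<epsilon> \<inter> Omega N n p A C S k"

text \<open>The second conjunct follows from the first, as the sets \<open>Omega_upto\<close> decrease in their last
  argument; it records that the stabilised set is \<open>Omega_eps\<close>.\<close>

definition finitely_determined ::
  "nat \<Rightarrow> nat \<Rightarrow> nat \<Rightarrow> nat \<Rightarrow> (nat \<Rightarrow> real mat) \<Rightarrow> (nat \<Rightarrow> real mat) \<Rightarrow> (nat \<Rightarrow> real mat) \<Rightarrow>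
   real \<Rightarrow> nat \<Rightarrow> bool" where
  "finitely_determined N n p d A C S \<epsilon> k \<longleftrightarrow>
     (\<exists>j\<^sub>0\<ge>k.
        (\<forall>j\<ge>j\<^sub>0. Omega_ss N n d A C S \<epsilon> \<inter> Omega_upto N n p A C S k j
                = Omega_ss N n d A C S \<epsilon> \<inter> Omega_upto N n p A C S k j\<^sub>0) \<and>
        Omega_eps N n p d A C S \<epsilon> k = Omega_ss N n d A C S \<epsilon> \<inter> Omega_upto N n p A C S k j\<^sub>0)"

end

theory Submission
  imports Defs "Jordan_Normal_Form.Spectral_Radius"
begin

text \<open>
  Write \<open>T l = A (l - 1) * \<dots> * A 0\<close>, and let \<open>w\<close> be the state at time \<open>N\<close> of a solution that
  starts at phase \<open>k\<close>. Its output at time \<open>N + N r + l\<close>, where \<open>l < N\<close>, is \<open>C l * T l * \<Phi>\<^sup>r w\<close>. Two facts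
  about these outputs give a horizon that does not depend on the initial state.

  They converge uniformly on bounded sets of \<open>w\<close>. Since \<open>\<Phi>\<^sub>s\<close> is stable and \<open>\<Phi>\<close> fixes the last \<open>d\<close>
  coordinates, \<open>\<Phi>\<^sup>r\<close> converges entrywise to a matrix \<open>steady_map\<close> (\<open>Phi_power_tendsto\<close>). This matrix
  satisfies \<open>steady_map * A t = steady_map\<close> (\<open>steady_map_mult_A\<close>), so \<open>w\<close> and the initial state
  \<open>x\<^sub>0\<close> have the same steady state, and its lifted output is \<open>\<Gamma> x\<^sub>0\<close> (\<open>Gamma_eq\<close>). For \<open>x\<^sub>0\<close> in \<open>\<Omega>\<^sub>s\<^sub>s\<close>
  the limits thus satisfy the constraints with margin \<open>\<epsilon>\<close> (\<open>Omega_ss_steady_output\<close>).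

  The admissible \<open>w\<close> form a bounded set. Finitely many outputs after time \<open>N\<close> determine \<open>w\<close> by
  observability, hence bound it linearly (\<open>observable_state_bound\<close>), and the constraint sets are
  compact.

  So all states that satisfy the constraints long enough share a time after which every constraint
  function exceeds its limit by at most the margin, and from then on no constraint can be violated.
\<close>

unbundle no vec_syntax
unbundle no inner_syntax

section \<open>Bounds from separating functionals and from compactness\<close>

text \<open>Functionals \<open>u i\<close> whose only common zero is \<open>0\<close> have the invertible Gram matrix
  \<open>G = (\<Sum>i. u i (u i)\<^sup>T)\<close>: if \<open>G v = 0\<close>, then \<open>0 = v \<bullet> G v = (\<Sum>i. (u i \<bullet> v)\<^sup>2)\<close>. Hence
  \<open>z = G\<^sup>-\<^sup>1 (\<Sum>i. (u i \<bullet> z) u i)\<close> depends linearly on the values \<open>u i \<bullet> z\<close>, which is where \<open>K\<close>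
  comes from. Applied to the rows of the output maps, this is the quantitative form of
  observability.\<close>

lemma separating_functionals_bound:
  fixes u :: "'i \<Rightarrow> real Matrix.vec"
  assumes fin: "finite I" and u: "\<And>i. i \<in> I \<Longrightarrow> u i \<in> carrier_vec n"
    and sep: "\<And>z. z \<in> carrier_vec n \<Longrightarrow> (\<And>i. i \<in> I \<Longrightarrow> u i \<bullet> z = 0) \<Longrightarrow> z = 0\<^sub>v n"
  obtains K where "\<And>z B a. z \<in> carrier_vec n \<Longrightarrow> (\<And>i. i \<in> I \<Longrightarrow> \<bar>u i \<bullet> z\<bar> \<le> B) \<Longrightarrow>
    B \<ge> 0 \<Longrightarrow> a < n \<Longrightarrow> \<bar>z $ a\<bar> \<le> K * B"
proof -
  define G where "G = mat n n (\<lambda>(a,b). \<Sum>i\<in>I. u i $ a * u i $ b)"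
  have G: "G \<in> carrier_mat n n" by (simp add: G_def)
  have G_mult: "(G *\<^sub>v z) $ a = (\<Sum>i\<in>I. u i $ a * (u i \<bullet> z))"
    if z: "z \<in> carrier_vec n" and a: "a < n" for z a
  proof -
    have "(G *\<^sub>v z) $ a = (\<Sum>b<n. (\<Sum>i\<in>I. u i $ a * u i $ b) * z $ b)"
      using a z G by (simp add: G_def scalar_prod_def lessThan_atLeast0)
    also have "\<dots> = (\<Sum>i\<in>I. \<Sum>b<n. u i $ a * u i $ b * z $ b)"
      unfolding sum_distrib_right by (rule sum.swap)
    also have "\<dots> = (\<Sum>i\<in>I. u i $ a * (u i \<bullet> z))"
      using z by (simp add: scalar_prod_def sum_distrib_left lessThan_atLeast0 mult.assoc)
    finally show ?thesis .
  qed
  have "det G \<noteq> 0"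
  proof
    assume "det G = 0"
    then obtain v where v: "v \<in> carrier_vec n" "v \<noteq> 0\<^sub>v n" "G *\<^sub>v v = 0\<^sub>v n"
      using det_0_iff_vec_prod_zero_field[OF G] by auto
    have "0 = (\<Sum>a<n. v $ a * (G *\<^sub>v v) $ a)"
      using v by simp
    also have "\<dots> = (\<Sum>a<n. \<Sum>i\<in>I. v $ a * (u i $ a * (u i \<bullet> v)))"
      by (intro sum.cong refl) (simp add: G_mult[OF v(1)] sum_distrib_left del: index_mult_mat_vec)
    also have "\<dots> = (\<Sum>i\<in>I. \<Sum>a<n. v $ a * (u i $ a * (u i \<bullet> v)))"
      by (rule sum.swap)
    also have "\<dots> = (\<Sum>i\<in>I. (u i \<bullet> v)\<^sup>2)"
    proof (rule sum.cong[OF refl])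
      fix i assume "i \<in> I"
      have "(\<Sum>a<n. v $ a * (u i $ a * (u i \<bullet> v))) = (\<Sum>a<n. u i $ a * v $ a) * (u i \<bullet> v)"
        unfolding sum_distrib_right by (simp add: ac_simps)
      also have "(\<Sum>a<n. u i $ a * v $ a) = u i \<bullet> v"
        using v by (simp add: scalar_prod_def lessThan_atLeast0)
      finally show "(\<Sum>a<n. v $ a * (u i $ a * (u i \<bullet> v))) = (u i \<bullet> v)\<^sup>2"
        by (simp add: power2_eq_square)
    qed
    finally have "\<forall>i\<in>I. (u i \<bullet> v)\<^sup>2 = 0"
      using sum_nonneg_eq_0_iff[OF fin, of "\<lambda>i. (u i \<bullet> v)\<^sup>2"] by simp
    then have "v = 0\<^sub>v n" using sep[OF v(1)] by simp
    with v show False by simp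
  qed
  then obtain H where H: "H \<in> carrier_mat n n" "H * G = 1\<^sub>m n"
    using det_non_zero_imp_unit[OF G, of "()"] unfolding Units_def ring_mat_def by auto
  define K where "K = (\<Sum>a<n. \<Sum>b<n. \<bar>H $$ (a,b)\<bar> * (\<Sum>i\<in>I. \<bar>u i $ b\<bar>))"
  show ?thesis
  proof (rule that[of K])
    fix z :: "real Matrix.vec" and B :: real and a
    assume z: "z \<in> carrier_vec n" and bd: "\<And>i. i \<in> I \<Longrightarrow> \<bar>u i \<bullet> z\<bar> \<le> B"
      and B: "B \<ge> 0" and a: "a < n"
    have Gz: "G *\<^sub>v z \<in> carrier_vec n" by (rule mult_mat_vec_carrier[OF G z])
    have expand: "(H *\<^sub>v y) $ a = (\<Sum>b<n. H $$ (a,b) * y $ b)" if "y \<in> carrier_vec n" for y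
      using that a H(1) by (simp add: scalar_prod_def lessThan_atLeast0)
    have "H *\<^sub>v (G *\<^sub>v z) = z"
      using H(2) z assoc_mult_mat_vec[OF H(1) G z] by simp
    then have "z $ a = (\<Sum>b<n. H $$ (a,b) * (G *\<^sub>v z) $ b)"
      using expand[OF Gz] by (simp only:)
    also have "\<bar>\<dots>\<bar> \<le> (\<Sum>b<n. \<bar>H $$ (a,b)\<bar> * ((\<Sum>i\<in>I. \<bar>u i $ b\<bar>) * B))"
    proof (rule order.trans[OF sum_abs], rule sum_mono)
      fix b assume "b \<in> {..<n}"
      then have "\<bar>(G *\<^sub>v z) $ b\<bar> = \<bar>\<Sum>i\<in>I. u i $ b * (u i \<bullet> z)\<bar>"
        by (simp add: G_mult[OF z] del: index_mult_mat_vec)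
      also have "\<dots> \<le> (\<Sum>i\<in>I. \<bar>u i $ b\<bar> * B)"
        by (rule order.trans[OF sum_abs], rule sum_mono) (auto simp: abs_mult bd intro!: mult_left_mono)
      finally show "\<bar>H $$ (a,b) * (G *\<^sub>v z) $ b\<bar> \<le> \<bar>H $$ (a,b)\<bar> * ((\<Sum>i\<in>I. \<bar>u i $ b\<bar>) * B)"
        by (simp add: abs_mult mult_left_mono sum_distrib_right del: index_mult_mat_vec)
    qed
    also have "\<dots> = (\<Sum>b<n. \<bar>H $$ (a,b)\<bar> * (\<Sum>i\<in>I. \<bar>u i $ b\<bar>)) * B"
      by (simp add: sum_distrib_right mult.assoc)
    also have "\<dots> \<le> K * B"
      unfolding K_def
      by (rule mult_right_mono[OF _ B])
        (rule member_le_sum[of a "{..<n}" "\<lambda>a. \<Sum>b<n. \<bar>H $$ (a,b)\<bar> * (\<Sum>i\<in>I. \<bar>u i $ b\<bar>)"],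
          auto simp: a intro!: sum_nonneg mult_nonneg_nonneg)
    finally show "\<bar>z $ a\<bar> \<le> K * B" .
  qed
qed

text \<open>Coordinate projections are continuous for the product topology, so each coordinate is
  bounded on a compact set.\<close>

lemma compact_vecs_bounded:
  assumes "compact_vecs p Y"
  obtains B where "\<And>y j. y \<in> Y \<Longrightarrow> j < p \<Longrightarrow> \<bar>y $ j\<bar> \<le> B"
proof -
  have sub: "Y \<subseteq> carrier_vec p" and "compactin (Euclidean_space p) (padded ` Y)"
    using assms by (auto simp: compact_vecs_def)
  then have comp: "compact (padded ` Y)"
    by (simp add: Euclidean_space_def compactin_subtopology euclidean_product_topology)
  have "\<exists>b. \<forall>y\<in>Y. \<bar>padded y j\<bar> \<le> b" for j
  proof -
    have "compact ((\<lambda>f. f j) ` padded ` Y)"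
      by (intro compact_continuous_image[OF _ comp]
          continuous_on_subset[OF continuous_on_product_coordinates]) simp
    then show ?thesis
      using compact_imp_bounded by (fastforce simp: bounded_iff)
  qed
  then obtain b where b: "\<And>j y. y \<in> Y \<Longrightarrow> \<bar>padded y j\<bar> \<le> b j" by metis
  show ?thesis
  proof (rule that[of "\<Sum>j<p. \<bar>b j\<bar>"])
    fix y j assume y: "y \<in> Y" and j: "j < p"
    then have "\<bar>y $ j\<bar> \<le> b j"
      using b[OF y, of j] sub by (auto simp: padded_def)
    also have "\<dots> \<le> \<bar>b j\<bar>" by simp
    also have "\<dots> \<le> (\<Sum>j<p. \<bar>b j\<bar>)"
      by (rule member_le_sum) (auto simp: j)
    finally show "\<bar>y $ j\<bar> \<le> (\<Sum>j<p. \<bar>b j\<bar>)" .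
  qed
qed

section \<open>Entrywise limits and stable matrices\<close>

definition mat_tendsto :: "nat \<Rightarrow> nat \<Rightarrow> (nat \<Rightarrow> real mat) \<Rightarrow> real mat \<Rightarrow> bool" where
  "mat_tendsto nr nc X Y \<longleftrightarrow> (\<forall>i<nr. \<forall>j<nc. (\<lambda>r. X r $$ (i,j)) \<longlonglongrightarrow> Y $$ (i,j))"

lemma mat_tendsto_mult_left:
  assumes M: "M \<in> carrier_mat nr m" and X: "\<And>r. X r \<in> carrier_mat m nc" and Y: "Y \<in> carrier_mat m nc"
    and lim: "mat_tendsto m nc X Y"
  shows "mat_tendsto nr nc (\<lambda>r. M * X r) (M * Y)"
  unfolding mat_tendsto_def
proof (intro allI impI)
  fix i j assume i: "i < nr" and j: "j < nc"
  have eq: "(M * Z) $$ (i,j) = (\<Sum>l<m. M $$ (i,l) * Z $$ (l,j))" if "Z \<in> carrier_mat m nc" for Z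
    using M that i j by (simp add: scalar_prod_def lessThan_atLeast0)
  show "(\<lambda>r. (M * X r) $$ (i,j)) \<longlonglongrightarrow> (M * Y) $$ (i,j)"
    unfolding eq[OF X] eq[OF Y]
    using lim j by (intro tendsto_intros) (auto simp: mat_tendsto_def)
qed

lemma mat_tendsto_mult_right:
  assumes M: "M \<in> carrier_mat m nc" and X: "\<And>r. X r \<in> carrier_mat nr m" and Y: "Y \<in> carrier_mat nr m"
    and lim: "mat_tendsto nr m X Y"
  shows "mat_tendsto nr nc (\<lambda>r. X r * M) (Y * M)"
  unfolding mat_tendsto_def
proof (intro allI impI)
  fix i j assume i: "i < nr" and j: "j < nc"
  have eq: "(Z * M) $$ (i,j) = (\<Sum>l<m. Z $$ (i,l) * M $$ (l,j))" if "Z \<in> carrier_mat nr m" for Z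
    using M that i j by (simp add: scalar_prod_def lessThan_atLeast0)
  show "(\<lambda>r. (X r * M) $$ (i,j)) \<longlonglongrightarrow> (Y * M) $$ (i,j)"
    unfolding eq[OF X] eq[OF Y]
    using lim i by (intro tendsto_intros) (auto simp: mat_tendsto_def)
qed

text \<open>For matrices, entrywise convergence is convergence of the operators uniformly on bounded sets
  of vectors. This uniformity is what makes a single time horizon work for all initial
  states.\<close>

lemma mat_tendsto_uniform_on_bounded:
  assumes X: "\<And>r. X r \<in> carrier_mat nr nc" and Y: "Y \<in> carrier_mat nr nc"
    and lim: "mat_tendsto nr nc X Y" and \<delta>: "\<delta> > 0"
  shows "eventually (\<lambda>r. \<forall>w\<in>carrier_vec nc. (\<forall>j<nc. \<bar>w $ j\<bar> \<le> B) \<longrightarrow>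
           (\<forall>i<nr. (X r *\<^sub>v w) $ i \<le> (Y *\<^sub>v w) $ i + \<delta>)) sequentially"
proof -
  have "eventually (\<lambda>r. (\<Sum>j<nc. \<bar>X r $$ (i,j) - Y $$ (i,j)\<bar> * B) < \<delta>) sequentially"
    if i: "i < nr" for i
  proof -
    have "(\<lambda>r. \<Sum>j<nc. \<bar>X r $$ (i,j) - Y $$ (i,j)\<bar> * B)
        \<longlonglongrightarrow> (\<Sum>j<nc. \<bar>Y $$ (i,j) - Y $$ (i,j)\<bar> * B)"
      using lim i by (intro tendsto_intros) (auto simp: mat_tendsto_def)
    then show ?thesis
      using \<delta> by (intro order_tendstoD(2)) auto
  qed
  then have "eventually (\<lambda>r. \<forall>i\<in>{..<nr}. (\<Sum>j<nc. \<bar>X r $$ (i,j) - Y $$ (i,j)\<bar> * B) < \<delta>) sequentially"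
    by (intro eventually_ball_finite) auto
  then show ?thesis
  proof eventually_elim
    case (elim r)
    show ?case
    proof (intro ballI impI allI)
      fix w :: "real Matrix.vec" and i
      assume w: "w \<in> carrier_vec nc" "\<forall>j<nc. \<bar>w $ j\<bar> \<le> B" and i: "i < nr"
      have eq: "(Z *\<^sub>v w) $ i = (\<Sum>j<nc. Z $$ (i,j) * w $ j)" if "Z \<in> carrier_mat nr nc" for Z
        using that w i by (simp add: scalar_prod_def lessThan_atLeast0)
      have "(X r *\<^sub>v w) $ i - (Y *\<^sub>v w) $ i = (\<Sum>j<nc. (X r $$ (i,j) - Y $$ (i,j)) * w $ j)"
        unfolding eq[OF X] eq[OF Y] by (simp add: sum_subtractf algebra_simps)
      also have "\<dots> \<le> (\<Sum>j<nc. \<bar>X r $$ (i,j) - Y $$ (i,j)\<bar> * B)"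
      proof (rule sum_mono)
        fix j assume "j \<in> {..<nc}"
        have "(X r $$ (i,j) - Y $$ (i,j)) * w $ j \<le> \<bar>X r $$ (i,j) - Y $$ (i,j)\<bar> * \<bar>w $ j\<bar>"
          by (metis abs_ge_self abs_mult)
        also have "\<dots> \<le> \<bar>X r $$ (i,j) - Y $$ (i,j)\<bar> * B"
          using w \<open>j \<in> {..<nc}\<close> by (intro mult_left_mono) auto
        finally show "(X r $$ (i,j) - Y $$ (i,j)) * w $ j \<le> \<bar>X r $$ (i,j) - Y $$ (i,j)\<bar> * B" .
      qed
      also have "\<dots> < \<delta>" using elim i by auto
      finally show "(X r *\<^sub>v w) $ i \<le> (Y *\<^sub>v w) $ i + \<delta>" by simp
    qed
  qed
qed

lemma smult_pow_mat:
  fixes M :: "'a::field mat"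
  assumes M: "M \<in> carrier_mat n n"
  shows "(c \<cdot>\<^sub>m M) ^\<^sub>m k = c ^ k \<cdot>\<^sub>m (M ^\<^sub>m k)"
proof (induction k)
  case 0
  show ?case using M by (intro eq_matI) auto
next
  case (Suc k)
  have Mk: "M ^\<^sub>m k \<in> carrier_mat n n" using M by simp
  have "(c \<cdot>\<^sub>m M) ^\<^sub>m Suc k = (c ^ k \<cdot>\<^sub>m (M ^\<^sub>m k)) * (c \<cdot>\<^sub>m M)"
    using Suc by simp
  also have "\<dots> = c ^ Suc k \<cdot>\<^sub>m (M ^\<^sub>m Suc k)"
    using M Mk by (intro eq_matI) (auto simp: mult_smult_assoc_mat[OF Mk] mult_smult_distrib[OF Mk M])
  finally show ?case .
qed

text \<open>Powers of a complex matrix with spectral radius below \<open>1\<close> are bounded. To get decay from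
  boundedness, choose \<open>s\<close> strictly between the spectral radius and \<open>1\<close>; then \<open>F / s\<close> still has
  spectral radius below \<open>1\<close>, so the entries of \<open>F\<^sup>k\<close> are \<open>O(s\<^sup>k)\<close>.\<close>

lemma pow_mat_tendsto_0:
  assumes F: "F \<in> carrier_mat m m"
    and stable: "\<And>z. eigenvalue (map_mat complex_of_real F) z \<Longrightarrow> cmod z < 1"
  shows "mat_tendsto m m (\<lambda>r. F ^\<^sub>m r) (0\<^sub>m m m)"
proof (cases "m = 0")
  case True
  then show ?thesis by (simp add: mat_tendsto_def)
next
  case False
  define M where "M = map_mat complex_of_real F"
  have M: "M \<in> carrier_mat m m" using F by (simp add: M_def)
  define \<rho> where "\<rho> = spectral_radius M"
  have "\<rho> \<in> cmod ` spectrum M"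
    unfolding \<rho>_def using spectral_radius_mem_max(1)[OF M] False by simp
  then have \<rho>: "0 \<le> \<rho>" "\<rho> < 1"
    using stable by (auto simp: spectrum_def M_def)
  then obtain s where s: "\<rho> < s" "s < 1" using dense by blast
  with \<rho> have s0: "s > 0" by simp
  define D where "D = complex_of_real (1 / s) \<cdot>\<^sub>m M"
  have D: "D \<in> carrier_mat m m" using M by (simp add: D_def)
  have "spectral_radius D < 1"
  proof -
    obtain z where z: "eigenvalue D z" "spectral_radius D = cmod z"
      using spectral_radius_mem_max(1)[OF D] False by (auto simp: spectrum_def)
    then obtain v where v: "v \<in> carrier_vec m" "v \<noteq> 0\<^sub>v m" "D *\<^sub>v v = z \<cdot>\<^sub>v v"
      using D by (auto simp: eigenvalue_def eigenvector_def)
    have "M = complex_of_real s \<cdot>\<^sub>m D"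
      using s0 by (intro eq_matI) (auto simp: D_def)
    then have "M *\<^sub>v v = complex_of_real s \<cdot>\<^sub>v (D *\<^sub>v v)"
      using v(1) D by (intro eq_vecI) (auto simp: row_smult)
    then have "M *\<^sub>v v = (complex_of_real s * z) \<cdot>\<^sub>v v"
      using v by (simp add: smult_smult_assoc)
    then have "eigenvalue M (complex_of_real s * z)"
      using v M by (auto simp: eigenvalue_def eigenvector_def)
    then have "cmod (complex_of_real s * z) \<le> \<rho>"
      unfolding \<rho>_def using spectral_radius_mem_max(2)[OF M] False by (auto simp: spectrum_def)
    then have "s * cmod z \<le> \<rho>" using s0 by (simp add: norm_mult)
    with s have "s * cmod z < s * 1" by linarith
    then have "cmod z < 1" using s0 mult_less_cancel_left_pos by blast
    with z show ?thesis by simp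
  qed
  then obtain c where c: "\<And>k. norm_bound (D ^\<^sub>m k) c"
    using spectral_radius_jnf_norm_bound_less_1_upper_triangular[OF D] by auto
  have bound: "\<bar>(F ^\<^sub>m k) $$ (i,j)\<bar> \<le> c * s ^ k" if ij: "i < m" "j < m" for i j k
  proof -
    have Fk: "F ^\<^sub>m k \<in> carrier_mat m m" using F by simp
    have hom: "M ^\<^sub>m k = map_mat complex_of_real (F ^\<^sub>m k)"
      unfolding M_def by (rule of_real_hom.mat_hom_pow[OF F, symmetric])
    have entry: "(a \<cdot>\<^sub>m map_mat complex_of_real X) $$ (i,j) = a * complex_of_real (X $$ (i,j))"
      if "X \<in> carrier_mat m m" for a X using that ij by simp
    have "D ^\<^sub>m k = complex_of_real (1 / s) ^ k \<cdot>\<^sub>m (M ^\<^sub>m k)"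
      unfolding D_def by (rule smult_pow_mat[OF M])
    then have "(D ^\<^sub>m k) $$ (i,j) = complex_of_real ((1 / s) ^ k * (F ^\<^sub>m k) $$ (i,j))"
      by (simp add: hom entry[OF Fk])
    moreover have "D ^\<^sub>m k \<in> carrier_mat m m" using D by simp
    ultimately have "\<bar>(1 / s) ^ k * (F ^\<^sub>m k) $$ (i,j)\<bar> \<le> c"
      using c[of k] ij by (metis carrier_matD norm_bound_def norm_of_real real_norm_def)
    then show ?thesis
      using s0 by (simp add: abs_mult power_divide field_simps)
  qed
  have "(\<lambda>k. c * s ^ k) \<longlonglongrightarrow> c * 0"
    using s s0 by (intro tendsto_intros LIMSEQ_realpow_zero) auto
  then have "(\<lambda>k. c * s ^ k) \<longlonglongrightarrow> 0" by simp
  then show ?thesis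
    unfolding mat_tendsto_def using bound
    by (auto intro!: Lim_null_comparison[where g = "\<lambda>k. c * s ^ k"])
qed

text \<open>A nonzero kernel vector of \<open>I - F\<close> is an eigenvector of \<open>F\<close> for the eigenvalue \<open>1\<close>, which
  stability excludes.\<close>

lemma inverse_one_minus:
  assumes F: "F \<in> carrier_mat m m"
    and stable: "\<And>z. eigenvalue (map_mat complex_of_real F) z \<Longrightarrow> cmod z < 1"
  shows "the (mat_inverse (1\<^sub>m m - F)) \<in> carrier_mat m m"
    "(1\<^sub>m m - F) * the (mat_inverse (1\<^sub>m m - F)) = 1\<^sub>m m"
proof -
  have I: "1\<^sub>m m - F \<in> carrier_mat m m" by (rule minus_carrier_mat[OF F])
  have "det (1\<^sub>m m - F) \<noteq> 0"
  proof
    assume "det (1\<^sub>m m - F) = 0"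
    then obtain v where v: "v \<in> carrier_vec m" "v \<noteq> 0\<^sub>v m" "(1\<^sub>m m - F) *\<^sub>v v = 0\<^sub>v m"
      using det_0_iff_vec_prod_zero_field[OF I] by auto
    have "(1\<^sub>m m - F) *\<^sub>v v = v - F *\<^sub>v v"
      using minus_mult_distrib_mat_vec[OF one_carrier_mat F v(1)] v by simp
    with v have eq: "v - F *\<^sub>v v = 0\<^sub>v m" by simp
    have "F *\<^sub>v v = 1 \<cdot>\<^sub>v v"
    proof (rule eq_vecI)
      fix i assume "i < dim_vec (1 \<cdot>\<^sub>v v)"
      then have i: "i < m" using v by simp
      have "(v - F *\<^sub>v v) $ i = 0" using eq i by simp
      then show "(F *\<^sub>v v) $ i = (1 \<cdot>\<^sub>v v) $ i" using i F v by simp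
    qed (use F v in auto)
    then have "eigenvalue F 1"
      using v F by (auto simp: eigenvalue_def eigenvector_def)
    then have "eigenvalue (map_mat complex_of_real F) (complex_of_real 1)"
      by (rule of_real_hom.eigenvalue_hom[OF F])
    then show False using stable by fastforce
  qed
  then have "1\<^sub>m m - F \<in> Units (ring_mat TYPE(real) m ())"
    by (rule det_non_zero_imp_unit[OF I])
  then obtain J where J: "mat_inverse (1\<^sub>m m - F) = Some J"
    using mat_inverse(1)[OF I, of "()"] by (cases "mat_inverse (1\<^sub>m m - F)") auto
  from mat_inverse(2)[OF I J] J
  show "the (mat_inverse (1\<^sub>m m - F)) \<in> carrier_mat m m"
    "(1\<^sub>m m - F) * the (mat_inverse (1\<^sub>m m - F)) = 1\<^sub>m m"
    by simp_all
qed

section \<open>Stacked vectors and block matrices\<close>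

definition concat_vecs :: "'a Matrix.vec list \<Rightarrow> 'a Matrix.vec" where
  "concat_vecs vs = foldr (@\<^sub>v) vs vNil"

lemma concat_vecs_simps [simp]:
  "concat_vecs [] = vNil"
  "concat_vecs (v # vs) = v @\<^sub>v concat_vecs vs"
  by (simp_all add: concat_vecs_def)

lemma all_entries_append:
  "(\<forall>i<dim_vec (v @\<^sub>v w). P ((v @\<^sub>v w) $ i)) \<longleftrightarrow> (\<forall>i<dim_vec v. P (v $ i)) \<and> (\<forall>i<dim_vec w. P (w $ i))"
proof (intro iffI conjI allI impI)
  assume all: "\<forall>i<dim_vec (v @\<^sub>v w). P ((v @\<^sub>v w) $ i)"
  show "P (v $ i)" if "i < dim_vec v" for i
    using all[rule_format, of i] that by simp
  show "P (w $ i)" if "i < dim_vec w" for i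
    using all[rule_format, of "dim_vec v + i"] that by simp
qed auto

lemma all_entries_concat_vecs:
  "(\<forall>i<dim_vec (concat_vecs vs). P (concat_vecs vs $ i)) \<longleftrightarrow> (\<forall>v\<in>set vs. \<forall>i<dim_vec v. P (v $ i))"
proof (induction vs)
  case (Cons v vs)
  then show ?case by (simp only: concat_vecs_simps all_entries_append) simp
qed simp

lemma mult_mat_vec_zero:
  assumes "M \<in> carrier_mat nr nc"
  shows "M *\<^sub>v 0\<^sub>v nc = 0\<^sub>v nr"
  using assms by (intro eq_vecI) (auto simp: scalar_prod_def)

lemma foldr_append_rows_carrier:
  assumes "\<And>M. M \<in> set Ms \<Longrightarrow> dim_col M = n"
  shows "foldr (@\<^sub>r) Ms (0\<^sub>m 0 n) \<in> carrier_mat (sum_list (map dim_row Ms)) n"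
  using assms
proof (induction Ms)
  case (Cons M Ms)
  then have "M \<in> carrier_mat (dim_row M) n" by auto
  from carrier_append_rows[OF this Cons.IH] Cons.prems show ?case by simp
qed simp

lemma foldr_append_rows_mult_vec:
  assumes "\<And>M. M \<in> set Ms \<Longrightarrow> dim_col M = n" and x: "x \<in> carrier_vec n"
  shows "foldr (@\<^sub>r) Ms (0\<^sub>m 0 n) *\<^sub>v x = concat_vecs (map (\<lambda>M. M *\<^sub>v x) Ms)"
  using assms(1)
proof (induction Ms)
  case Nil
  show ?case by (intro eq_vecI) auto
next
  case (Cons M Ms)
  have "(M @\<^sub>r foldr (@\<^sub>r) Ms (0\<^sub>m 0 n)) *\<^sub>v x
      = (M *\<^sub>v x) @\<^sub>v (foldr (@\<^sub>r) Ms (0\<^sub>m 0 n) *\<^sub>v x)"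
    using Cons by (intro mat_mult_append[OF _ foldr_append_rows_carrier x]) auto
  then show ?case using Cons by simp
qed

lemma diag_block_mat_mult_vec:
  fixes M :: "'k \<Rightarrow> 'a::semiring_0 mat"
  assumes "\<And>k. k \<in> set ks \<Longrightarrow> dim_vec (v k) = dim_col (M k)"
  shows "diag_block_mat (map M ks) *\<^sub>v concat_vecs (map v ks)
       = concat_vecs (map (\<lambda>k. M k *\<^sub>v v k) ks)"
  using assms
proof (induction ks)
  case Nil
  show ?case by (intro eq_vecI) auto
next
  case (Cons k ks)
  let ?D = "diag_block_mat (map M ks)" and ?w = "concat_vecs (map v ks)"
  have "dim_vec ?w = dim_col ?D"
    using Cons.prems by (induction ks) (auto simp: dim_diag_block_mat)
  then have D: "?D \<in> carrier_mat (dim_row ?D) (dim_col ?D)" and w: "?w \<in> carrier_vec (dim_col ?D)"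
    by (auto intro: carrier_vecI)
  have Mk: "M k \<in> carrier_mat (dim_row (M k)) (dim_col (M k))" and vk: "v k \<in> carrier_vec (dim_col (M k))"
    using Cons.prems by (auto intro: carrier_vecI)
  have "diag_block_mat (map M (k # ks)) *\<^sub>v concat_vecs (map v (k # ks))
      = (M k *\<^sub>v v k + 0\<^sub>m (dim_row (M k)) (dim_col ?D) *\<^sub>v ?w)
        @\<^sub>v (0\<^sub>m (dim_row ?D) (dim_col (M k)) *\<^sub>v v k + ?D *\<^sub>v ?w)"
    using four_block_mat_mult_vec[OF Mk _ _ D vk w] by (simp add: Let_def)
  also have "M k *\<^sub>v v k + 0\<^sub>m (dim_row (M k)) (dim_col ?D) *\<^sub>v ?w = M k *\<^sub>v v k"
    using w vk by (intro eq_vecI) auto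
  also have "0\<^sub>m (dim_row ?D) (dim_col (M k)) *\<^sub>v v k + ?D *\<^sub>v ?w = ?D *\<^sub>v ?w"
    using w vk by (intro eq_vecI) auto
  finally show ?case using Cons by simp
qed

section \<open>Solutions of a periodic system\<close>

lemma solution_add: "solution A k x (a + b) = solution A (k + a) (solution A k x a) b"
  by (induction b) (simp_all add: add.assoc)

lemma periodic_multiple:
  fixes f :: "nat \<Rightarrow> 'a"
  assumes "\<And>t. f (t + N) = f t"
  shows "f (t + N * r) = f t"
proof (induction r)
  case (Suc r)
  have eq: "t + N * Suc r = (t + N * r) + N" by simp
  show ?case unfolding eq assms by (rule Suc.IH)
qed simp

lemma phase_mod:
  fixes l N r :: nat
  assumes "l < N"
  shows "(N + N * r + l) mod N = l"
proof -
  have "(N + N * r + l) mod N = (l + N * Suc r) mod N"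
    by (rule arg_cong[where f = "\<lambda>t. t mod N"]) simp
  also have "\<dots> = l" using assms by (simp only: mod_mult_self2 mod_less)
  finally show ?thesis .
qed

locale periodic_system =
  fixes N n p d :: nat and A C :: "nat \<Rightarrow> real mat"
  assumes N: "N \<ge> 1"
    and A: "\<And>t. A t \<in> carrier_mat n n" and C: "\<And>t. C t \<in> carrier_mat p n"
    and A_periodic: "\<And>t. A (t + N) = A t" and C_periodic: "\<And>t. C (t + N) = C t"
    and d: "d \<le> n"
    and A_blocks: "\<And>k. k < N \<Longrightarrow> \<exists>As \<in> carrier_mat (n - d) (n - d). \<exists>Ac \<in> carrier_mat (n - d) d.
         A k = four_block_mat As Ac (0\<^sub>m d (n - d)) (1\<^sub>m d)"
    and stable: "\<And>z. eigenvalue (map_mat complex_of_real (Phi_s N n d A)) z \<Longrightarrow> cmod z < 1"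
begin

abbreviation "T \<equiv> transition n A"
abbreviation "\<Phi> \<equiv> Phi N n A"
abbreviation "\<Phi>\<^sub>s \<equiv> Phi_s N n d A"
abbreviation "\<Phi>\<^sub>c \<equiv> Phi_c N n d A"
abbreviation "L \<equiv> lifted_C N n A C"

lemma transition_carrier [simp]: "T t \<in> carrier_mat n n"
  by (induction t) (auto intro: mult_carrier_mat[OF A])

lemma Phi_carrier [simp]: "\<Phi> \<in> carrier_mat n n"
  by (simp add: Phi_def)

lemma solution_carrier: "x \<in> carrier_vec n \<Longrightarrow> solution A k x i \<in> carrier_vec n"
  by (induction i) (use A in \<open>auto intro: mult_mat_vec_carrier\<close>)

lemma A_periods: "A (t + N * r) = A t"
  by (rule periodic_multiple) (rule A_periodic)

lemma C_periods: "C (t + N * r) = C t"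
  by (rule periodic_multiple) (rule C_periodic)

lemma A_mod: "A t = A (t mod N)"
  using A_periods[of "t mod N" "t div N"] by simp

lemma solution_0: "x \<in> carrier_vec n \<Longrightarrow> solution A 0 x i = T i *\<^sub>v x"
  by (induction i) (use A in \<open>simp_all add: assoc_mult_mat_vec[OF A transition_carrier]\<close>)

lemma solution_period: "solution A (k + N) x i = solution A k x i"
  by (induction i) (use A_periodic[of "k + _"] in \<open>simp_all add: ac_simps\<close>)

lemma solution_from_period:
  assumes "w \<in> carrier_vec n"
  shows "solution A 0 w (N * r + l) = T l *\<^sub>v (\<Phi> ^\<^sub>m r *\<^sub>v w)"
  using assms
proof (induction r arbitrary: w)
  case 0
  then show ?case using Phi_carrier by (simp add: solution_0 carrier_matD[OF Phi_carrier])
next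
  case (Suc r)
  have "solution A 0 w (N * Suc r + l) = solution A (0 + N) (solution A 0 w N) (N * r + l)"
    using solution_add[of A 0 w N "N * r + l"] by (simp add: ac_simps)
  also have "\<dots> = solution A 0 (\<Phi> *\<^sub>v w) (N * r + l)"
    using Suc.prems by (simp only: solution_period solution_0 Phi_def)
  also have "\<dots> = T l *\<^sub>v (\<Phi> ^\<^sub>m r *\<^sub>v (\<Phi> *\<^sub>v w))"
    using Suc.prems by (intro Suc.IH mult_mat_vec_carrier[OF Phi_carrier])
  also have "\<Phi> ^\<^sub>m r *\<^sub>v (\<Phi> *\<^sub>v w) = \<Phi> ^\<^sub>m Suc r *\<^sub>v w"
    using Suc.prems assoc_mult_mat_vec[of "\<Phi> ^\<^sub>m r" n n \<Phi> n w] by simp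
  finally show ?case .
qed

text \<open>From time \<open>N\<close> on, the phase \<open>k\<close> at which the solution started is visible only through
  the state at time \<open>N\<close>, and the outputs are those of the lifted system. This treats all initial
  phases at once.\<close>

lemma output_after_first_period:
  assumes x: "x \<in> carrier_vec n" and k: "k < N"
  shows "C (N + N * r + l) *\<^sub>v solution A k x (N + N * r + l - k)
       = C l * T l * \<Phi> ^\<^sub>m r *\<^sub>v solution A k x (N - k)"
proof -
  let ?w = "solution A k x (N - k)"
  have w: "?w \<in> carrier_vec n" by (rule solution_carrier[OF x])
  have P: "\<Phi> ^\<^sub>m r \<in> carrier_mat n n" by simp
  have "solution A k x (N + N * r + l - k) = solution A k x ((N - k) + (N * r + l))"
    using k by (simp add: add.assoc)
  also have "\<dots> = solution A (0 + N) ?w (N * r + l)"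
    using k by (simp only: solution_add) simp
  also have "\<dots> = T l *\<^sub>v (\<Phi> ^\<^sub>m r *\<^sub>v ?w)"
    by (simp only: solution_period solution_from_period[OF w])
  finally have "solution A k x (N + N * r + l - k) = T l *\<^sub>v (\<Phi> ^\<^sub>m r *\<^sub>v ?w)" .
  moreover have "C (N + N * r + l) = C l"
    using C_periods[of l "Suc r"] by (simp add: ac_simps)
  moreover have "C l * T l * \<Phi> ^\<^sub>m r *\<^sub>v ?w = C l *\<^sub>v (T l *\<^sub>v (\<Phi> ^\<^sub>m r *\<^sub>v ?w))"
    using assoc_mult_mat_vec[OF mult_carrier_mat[OF C transition_carrier] P w]
      assoc_mult_mat_vec[OF C transition_carrier mult_mat_vec_carrier[OF P w]] by simp
  ultimately show ?thesis by simp
qed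

section \<open>The steady state\<close>

lemma A_block_form:
  obtains As Ac where "As \<in> carrier_mat (n - d) (n - d)" "Ac \<in> carrier_mat (n - d) d"
    "A t = four_block_mat As Ac (0\<^sub>m d (n - d)) (1\<^sub>m d)"
  using A_blocks[of "t mod N"] N A_mod[of t] by auto

lemma transition_block_form:
  "\<exists>Ts \<in> carrier_mat (n - d) (n - d). \<exists>Tc \<in> carrier_mat (n - d) d.
     T t = four_block_mat Ts Tc (0\<^sub>m d (n - d)) (1\<^sub>m d)"
proof (induction t)
  case 0
  have "1\<^sub>m n = four_block_mat (1\<^sub>m (n - d)) (0\<^sub>m (n - d) d) (0\<^sub>m d (n - d)) (1\<^sub>m d :: real mat)"
    using d by (intro eq_matI) auto
  then show ?case by (intro bexI[of _ "1\<^sub>m (n - d)"] bexI[of _ "0\<^sub>m (n - d) d"]) auto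
next
  case (Suc t)
  then obtain Ts Tc where T: "Ts \<in> carrier_mat (n - d) (n - d)" "Tc \<in> carrier_mat (n - d) d"
    "T t = four_block_mat Ts Tc (0\<^sub>m d (n - d)) (1\<^sub>m d)" by auto
  obtain As Ac where At: "As \<in> carrier_mat (n - d) (n - d)" "Ac \<in> carrier_mat (n - d) d"
    "A t = four_block_mat As Ac (0\<^sub>m d (n - d)) (1\<^sub>m d)" by (rule A_block_form)
  have "T (Suc t) = four_block_mat (As * Ts) (As * Tc + Ac) (0\<^sub>m d (n - d)) (1\<^sub>m d)"
    using T At by (simp add: mult_four_block_mat[OF At(1,2) zero_carrier_mat one_carrier_mat
          T(1,2) zero_carrier_mat one_carrier_mat])
  then show ?case using T At
    by (intro bexI[of _ "As * Ts"] bexI[of _ "As * Tc + Ac"]) auto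
qed

lemma Phi_block_form: "\<Phi> = four_block_mat \<Phi>\<^sub>s \<Phi>\<^sub>c (0\<^sub>m d (n - d)) (1\<^sub>m d)"
  and Phi_s_carrier: "\<Phi>\<^sub>s \<in> carrier_mat (n - d) (n - d)"
  and Phi_c_carrier: "\<Phi>\<^sub>c \<in> carrier_mat (n - d) d"
proof -
  obtain Ts Tc where T: "Ts \<in> carrier_mat (n - d) (n - d)" "Tc \<in> carrier_mat (n - d) d"
    "\<Phi> = four_block_mat Ts Tc (0\<^sub>m d (n - d)) (1\<^sub>m d)"
    unfolding Phi_def using transition_block_form by blast
  have "\<Phi>\<^sub>s = Ts" "\<Phi>\<^sub>c = Tc"
    using T d by (auto simp: Phi_s_def Phi_c_def split_block_def Let_def intro!: eq_matI)
  with T show "\<Phi> = four_block_mat \<Phi>\<^sub>s \<Phi>\<^sub>c (0\<^sub>m d (n - d)) (1\<^sub>m d)"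
    "\<Phi>\<^sub>s \<in> carrier_mat (n - d) (n - d)" "\<Phi>\<^sub>c \<in> carrier_mat (n - d) d" by simp_all
qed

lemma resolvent:
  "the (mat_inverse (1\<^sub>m (n - d) - \<Phi>\<^sub>s)) \<in> carrier_mat (n - d) (n - d)"
  "(1\<^sub>m (n - d) - \<Phi>\<^sub>s) * the (mat_inverse (1\<^sub>m (n - d) - \<Phi>\<^sub>s)) = 1\<^sub>m (n - d)"
  by (rule inverse_one_minus[OF Phi_s_carrier]; erule stable)+

text \<open>Since \<open>\<Phi>\<close> acts as the identity on the last \<open>d\<close> coordinates \<open>c\<close>, its trajectories tend to
  the fixed point \<open>((I - \<Phi>\<^sub>s)\<^sup>-\<^sup>1 \<Phi>\<^sub>c c, c)\<close>. The matrix \<open>steady_map\<close> sends a state to this limit.\<close>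

definition steady_gain :: "real mat" where
  "steady_gain = the (mat_inverse (1\<^sub>m (n - d) - \<Phi>\<^sub>s)) * \<Phi>\<^sub>c"

definition steady_map :: "real mat" where
  "steady_map = four_block_mat (0\<^sub>m (n - d) (n - d)) steady_gain (0\<^sub>m d (n - d)) (1\<^sub>m d)"

lemma steady_gain_carrier: "steady_gain \<in> carrier_mat (n - d) d"
  unfolding steady_gain_def by (rule mult_carrier_mat[OF resolvent(1) Phi_c_carrier])

lemma steady_gain_fixed: "\<Phi>\<^sub>c = steady_gain - \<Phi>\<^sub>s * steady_gain"
proof -
  let ?J = "the (mat_inverse (1\<^sub>m (n - d) - \<Phi>\<^sub>s))"
  note J = resolvent
  have "\<Phi>\<^sub>c = ((1\<^sub>m (n - d) - \<Phi>\<^sub>s) * ?J) * \<Phi>\<^sub>c"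
    using J Phi_c_carrier by simp
  also have "\<dots> = (1\<^sub>m (n - d) - \<Phi>\<^sub>s) * steady_gain"
    unfolding steady_gain_def
    by (rule assoc_mult_mat[OF minus_carrier_mat[OF Phi_s_carrier] J(1) Phi_c_carrier])
  also have "\<dots> = steady_gain - \<Phi>\<^sub>s * steady_gain"
    using minus_mult_distrib_mat[OF one_carrier_mat Phi_s_carrier steady_gain_carrier]
      left_mult_one_mat[OF steady_gain_carrier] by simp
  finally show ?thesis .
qed

lemma steady_map_carrier: "steady_map \<in> carrier_mat n n"
  unfolding steady_map_def
  using four_block_carrier_mat[OF zero_carrier_mat[of "n - d" "n - d"] one_carrier_mat[of d]] d by simp

text \<open>The steady state depends only on the last \<open>d\<close> coordinates, which every \<open>A t\<close> preserves. So
  it is constant along solutions, and may be evaluated at the initial state of any phase.\<close>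

lemma steady_map_mult_A: "steady_map * A t = steady_map"
proof -
  obtain As Ac where At: "As \<in> carrier_mat (n - d) (n - d)" "Ac \<in> carrier_mat (n - d) d"
    "A t = four_block_mat As Ac (0\<^sub>m d (n - d)) (1\<^sub>m d)" by (rule A_block_form)
  show ?thesis
    unfolding steady_map_def At(3)
    using At(1,2) steady_gain_carrier
    by (simp add: mult_four_block_mat[OF zero_carrier_mat steady_gain_carrier zero_carrier_mat one_carrier_mat
          At(1,2) zero_carrier_mat one_carrier_mat])
qed

lemma steady_map_solution:
  assumes "x \<in> carrier_vec n"
  shows "steady_map *\<^sub>v solution A k x i = steady_map *\<^sub>v x"
proof (induction i)
  case (Suc i)
  have "steady_map *\<^sub>v solution A k x (Suc i) = (steady_map * A (k + i)) *\<^sub>v solution A k x i"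
    using assoc_mult_mat_vec[OF steady_map_carrier A solution_carrier[OF assms]] by simp
  then show ?case using Suc by (simp add: steady_map_mult_A)
qed simp

text \<open>The upper right corner is the geometric sum \<open>(I + \<Phi>\<^sub>s + \<dots> + \<Phi>\<^sub>s\<^sup>r\<^sup>-\<^sup>1) \<Phi>\<^sub>c\<close> in closed form,
  from which the limit can be read off.\<close>

lemma Phi_power_block_form:
  "\<Phi> ^\<^sub>m r = four_block_mat (\<Phi>\<^sub>s ^\<^sub>m r) (steady_gain - \<Phi>\<^sub>s ^\<^sub>m r * steady_gain) (0\<^sub>m d (n - d)) (1\<^sub>m d)"
proof (induction r)
  case 0
  have "1\<^sub>m n = four_block_mat (1\<^sub>m (n - d)) (0\<^sub>m (n - d) d) (0\<^sub>m d (n - d)) (1\<^sub>m d :: real mat)"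
    using d by (intro eq_matI) auto
  moreover have "steady_gain - 1\<^sub>m (n - d) * steady_gain = 0\<^sub>m (n - d) d"
    using steady_gain_carrier by (intro eq_matI) auto
  moreover have "\<Phi> ^\<^sub>m 0 = 1\<^sub>m n" "\<Phi>\<^sub>s ^\<^sub>m 0 = 1\<^sub>m (n - d)"
    using carrier_matD[OF Phi_carrier] carrier_matD[OF Phi_s_carrier] by simp_all
  ultimately show ?case by (simp only:)
next
  case (Suc r)
  let ?F = "\<Phi>\<^sub>s ^\<^sub>m r"
  have F: "?F \<in> carrier_mat (n - d) (n - d)" using Phi_s_carrier by simp
  have FP: "?F * steady_gain \<in> carrier_mat (n - d) d" using F steady_gain_carrier by simp
  have FsP: "\<Phi>\<^sub>s * steady_gain \<in> carrier_mat (n - d) d" using Phi_s_carrier steady_gain_carrier by simp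
  have "?F * \<Phi>\<^sub>c = ?F * steady_gain - ?F * \<Phi>\<^sub>s * steady_gain"
    using mult_minus_distrib_mat[OF F steady_gain_carrier FsP] assoc_mult_mat[OF F Phi_s_carrier steady_gain_carrier]
    by (subst steady_gain_fixed) simp
  then have corner: "?F * \<Phi>\<^sub>c + (steady_gain - ?F * steady_gain) = steady_gain - ?F * \<Phi>\<^sub>s * steady_gain"
    using F FP steady_gain_carrier Phi_s_carrier
    by (intro eq_matI) (auto simp: assoc_mult_mat[OF F Phi_s_carrier steady_gain_carrier]
        simp del: index_mult_mat(1))
  have X: "steady_gain - ?F * steady_gain \<in> carrier_mat (n - d) d" by (rule minus_carrier_mat[OF FP])
  have FFs: "?F * \<Phi>\<^sub>s \<in> carrier_mat (n - d) (n - d)" by (rule mult_carrier_mat[OF F Phi_s_carrier])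
  have "\<Phi> ^\<^sub>m Suc r = four_block_mat ?F (steady_gain - ?F * steady_gain) (0\<^sub>m d (n - d)) (1\<^sub>m d)
      * four_block_mat \<Phi>\<^sub>s \<Phi>\<^sub>c (0\<^sub>m d (n - d)) (1\<^sub>m d)"
    by (simp only: pow_mat.simps(2) Suc flip: Phi_block_form)
  also have "\<dots> = four_block_mat (?F * \<Phi>\<^sub>s + (steady_gain - ?F * steady_gain) * 0\<^sub>m d (n - d))
      (?F * \<Phi>\<^sub>c + (steady_gain - ?F * steady_gain) * 1\<^sub>m d)
      (0\<^sub>m d (n - d) * \<Phi>\<^sub>s + 1\<^sub>m d * 0\<^sub>m d (n - d)) (0\<^sub>m d (n - d) * \<Phi>\<^sub>c + 1\<^sub>m d * 1\<^sub>m d)"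
    by (rule mult_four_block_mat[OF F X zero_carrier_mat one_carrier_mat
          Phi_s_carrier Phi_c_carrier zero_carrier_mat one_carrier_mat])
  also have "\<dots> = four_block_mat (\<Phi>\<^sub>s ^\<^sub>m Suc r) (steady_gain - \<Phi>\<^sub>s ^\<^sub>m Suc r * steady_gain) (0\<^sub>m d (n - d)) (1\<^sub>m d)"
    using Phi_s_carrier Phi_c_carrier
    by (simp only: pow_mat.simps(2) right_mult_zero_mat[OF X] right_mult_one_mat[OF X] corner
        right_add_zero_mat[OF FFs]) simp
  finally show ?case .
qed

lemma Phi_power_tendsto: "mat_tendsto n n (\<lambda>r. \<Phi> ^\<^sub>m r) steady_map"
proof -
  have F: "\<Phi>\<^sub>s ^\<^sub>m r \<in> carrier_mat (n - d) (n - d)" for r using Phi_s_carrier by simp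
  have lim: "mat_tendsto (n - d) (n - d) (\<lambda>r. \<Phi>\<^sub>s ^\<^sub>m r) (0\<^sub>m (n - d) (n - d))"
    by (rule pow_mat_tendsto_0[OF Phi_s_carrier stable])
  have limP: "mat_tendsto (n - d) d (\<lambda>r. \<Phi>\<^sub>s ^\<^sub>m r * steady_gain) (0\<^sub>m (n - d) (n - d) * steady_gain)"
    by (rule mat_tendsto_mult_right[OF steady_gain_carrier F zero_carrier_mat lim])
  show ?thesis
    unfolding mat_tendsto_def
  proof (intro allI impI)
    fix i j assume i: "i < n" and j: "j < n"
    show "(\<lambda>r. (\<Phi> ^\<^sub>m r) $$ (i,j)) \<longlonglongrightarrow> steady_map $$ (i,j)"
    proof (cases "i < n - d")
      case False
      then have "(\<Phi> ^\<^sub>m r) $$ (i,j) = steady_map $$ (i,j)" for r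
        unfolding Phi_power_block_form steady_map_def
        using i j d carrier_matD[OF F, of r] carrier_matD[OF steady_gain_carrier] by simp
      then show ?thesis by simp
    next
      case True
      show ?thesis
      proof (cases "j < n - d")
        case j': True
        have "(\<Phi> ^\<^sub>m r) $$ (i,j) = (\<Phi>\<^sub>s ^\<^sub>m r) $$ (i,j)" "steady_map $$ (i,j) = 0\<^sub>m (n - d) (n - d) $$ (i,j)" for r
          unfolding Phi_power_block_form steady_map_def
          using True j' i j d carrier_matD[OF F, of r] carrier_matD[OF steady_gain_carrier] by simp_all
        with lim True j' show ?thesis by (simp only: mat_tendsto_def)
      next
        case j': False
        let ?j = "j - (n - d)"
        have jd: "?j < d" using j j' d by simp
        have "(\<Phi> ^\<^sub>m r) $$ (i,j) = steady_gain $$ (i,?j) - (\<Phi>\<^sub>s ^\<^sub>m r * steady_gain) $$ (i,?j)" for r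
          unfolding Phi_power_block_form
          using True j' i j d jd carrier_matD[OF F, of r] carrier_matD[OF steady_gain_carrier]
          by (simp del: index_mult_mat(1))
        moreover have "steady_map $$ (i,j) = steady_gain $$ (i,?j) - (0\<^sub>m (n - d) (n - d) * steady_gain) $$ (i,?j)"
          unfolding steady_map_def
          using True j' i j d jd carrier_matD[OF steady_gain_carrier] by simp
        moreover have "(\<lambda>r. steady_gain $$ (i,?j) - (\<Phi>\<^sub>s ^\<^sub>m r * steady_gain) $$ (i,?j))
            \<longlonglongrightarrow> steady_gain $$ (i,?j) - (0\<^sub>m (n - d) (n - d) * steady_gain) $$ (i,?j)"
          using limP True jd by (intro tendsto_intros) (simp only: mat_tendsto_def)
        ultimately show ?thesis by simp
      qed
    qed
  qed
qed

lemma lifted_C_carrier: "L \<in> carrier_mat (N * p) n"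
proof -
  have dims: "map dim_row (map (\<lambda>k. C k * T k) [0..<N]) = map (\<lambda>k. p) [0..<N]"
    using carrier_matD[OF C] by simp
  have "sum_list (map dim_row (map (\<lambda>k. C k * T k) [0..<N])) = N * p"
    unfolding dims by (simp add: sum_list_triv)
  moreover have "L \<in> carrier_mat (sum_list (map dim_row (map (\<lambda>k. C k * T k) [0..<N]))) n"
    unfolding lifted_C_def
    by (rule foldr_append_rows_carrier) (auto simp: carrier_matD[OF transition_carrier])
  ultimately show ?thesis by (simp only:)
qed

lemma lifted_C_mult_vec:
  assumes "x \<in> carrier_vec n"
  shows "L *\<^sub>v x = concat_vecs (map (\<lambda>k. C k * T k *\<^sub>v x) [0..<N])"
  unfolding lifted_C_def
  by (subst foldr_append_rows_mult_vec[OF _ assms])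
     (auto simp: carrier_matD[OF transition_carrier] o_def)

section \<open>Steady-state constraints and observability\<close>

text \<open>\<open>\<Gamma>\<close> reads off the lifted output of the steady state; this turns the condition defining
  \<open>\<Omega>\<^sub>s\<^sub>s\<close> into a statement about the limits of the outputs.\<close>

lemma Gamma_eq: "Gamma N n d A C = L * steady_map"
proof -
  let ?m = "dim_row L"
  let ?Cs = "C_s N n d A C" and ?Cc = "C_c N n d A C"
  obtain M1 M2 M3 M4 where split: "split_block L ?m (n - d) = (M1, M2, M3, M4)"
    by (metis prod_cases4)
  \<comment> \<open>The split takes all rows, so the lower blocks \<open>M3\<close> and \<open>M4\<close> have no rows.\<close>
  have Ldim: "dim_col L = (n - d) + d" using lifted_C_carrier d by simp
  have row: "dim_row L = ?m + 0" by simp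
  note M = split_block[OF split row Ldim]
  have Cs: "?Cs = M1" and Cc: "?Cc = M2"
    using split by (simp_all add: C_s_def C_c_def Let_def)
  let ?J = "the (mat_inverse (1\<^sub>m (n - d) - \<Phi>\<^sub>s))"
  note J = resolvent(1)
  have "L * steady_map = four_block_mat (M1 * 0\<^sub>m (n - d) (n - d) + M2 * 0\<^sub>m d (n - d)) (M1 * steady_gain + M2 * 1\<^sub>m d)
      (M3 * 0\<^sub>m (n - d) (n - d) + M4 * 0\<^sub>m d (n - d)) (M3 * steady_gain + M4 * 1\<^sub>m d)"
    unfolding steady_map_def
    by (subst M(5)) (rule mult_four_block_mat[OF M(1-4) zero_carrier_mat steady_gain_carrier
          zero_carrier_mat one_carrier_mat])
  also have "M1 * 0\<^sub>m (n - d) (n - d) + M2 * 0\<^sub>m d (n - d) = 0\<^sub>m ?m (n - d)"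
    using M(1-4) by simp
  also have "M1 * steady_gain + M2 * 1\<^sub>m d = M1 * ?J * \<Phi>\<^sub>c + M2"
    using M(1-4) assoc_mult_mat[OF M(1) J Phi_c_carrier] by (simp add: steady_gain_def)
  also have "M3 * 0\<^sub>m (n - d) (n - d) + M4 * 0\<^sub>m d (n - d) = 0\<^sub>m 0 (n - d)"
    using M(1-4) by simp
  also have "M3 * steady_gain + M4 * 1\<^sub>m d = 0\<^sub>m 0 d"
    using M(3,4) by (intro eq_matI) auto
  finally show ?thesis
    using carrier_matD[OF M(1)] carrier_matD[OF M(2)] carrier_matD[OF Phi_c_carrier]
    by (simp add: Gamma_def append_cols_def Cs Cc)
qed

text \<open>Both \<open>S\<close> and the lifted output decompose into blocks indexed by the phase \<open>l\<close>, so the stacked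
  inequality is one inequality per phase.\<close>

lemma Omega_ss_steady_output:
  assumes S: "\<And>k. k < N \<Longrightarrow> S k \<in> carrier_mat (q k) p"
    and x: "x \<in> Omega_ss N n d A C S \<epsilon>" and l: "l < N" and i: "i < q l"
  shows "(S l * (C l * T l) * steady_map *\<^sub>v x) $ i \<le> 1 - \<epsilon>"
proof -
  have x_carrier: "x \<in> carrier_vec n" using x by (simp add: Omega_ss_def)
  have Ex: "steady_map *\<^sub>v x \<in> carrier_vec n" by (rule mult_mat_vec_carrier[OF steady_map_carrier x_carrier])
  let ?S = "lifted_S N S"
  let ?ws = "map (\<lambda>k. S k *\<^sub>v (C k * T k *\<^sub>v (steady_map *\<^sub>v x))) [0..<N]"
  have block_dim: "dim_vec (C k * T k *\<^sub>v (steady_map *\<^sub>v x)) = dim_col (S k)" if "k \<in> set [0..<N]" for k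
    using that S[of k] C[of k] by auto
  have dims: "map dim_col (map S [0..<N]) = map (\<lambda>k. p) [0..<N]"
    using carrier_matD[OF S] by simp
  have "sum_list (map dim_col (map S [0..<N])) = N * p"
    unfolding dims by (simp add: sum_list_triv)
  then have S_carrier: "?S \<in> carrier_mat (dim_row ?S) (N * p)"
    by (intro carrier_matI) (simp_all only: lifted_S_def dim_diag_block_mat)
  have "?S * Gamma N n d A C *\<^sub>v x = ?S *\<^sub>v (L *\<^sub>v (steady_map *\<^sub>v x))"
    using assoc_mult_mat_vec[OF S_carrier mult_carrier_mat[OF lifted_C_carrier steady_map_carrier] x_carrier]
      assoc_mult_mat_vec[OF lifted_C_carrier steady_map_carrier x_carrier] by (simp add: Gamma_eq)
  also have "\<dots> = concat_vecs ?ws"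
    unfolding lifted_C_mult_vec[OF Ex] lifted_S_def using block_dim
    by (rule diag_block_mat_mult_vec)
  finally have eq: "?S * Gamma N n d A C *\<^sub>v x = concat_vecs ?ws" .
  have "concat_vecs ?ws \<le> (1 - \<epsilon>) \<cdot>\<^sub>v ones_vec (dim_row ?S)"
    using x unfolding Omega_ss_def eq[symmetric] by simp
  then have "\<forall>i<dim_vec (concat_vecs ?ws). concat_vecs ?ws $ i \<le> 1 - \<epsilon>"
    by (auto simp: less_eq_vec_def ones_vec_def)
  then have "\<forall>w\<in>set ?ws. \<forall>i<dim_vec w. w $ i \<le> 1 - \<epsilon>"
    using all_entries_concat_vecs[of ?ws "\<lambda>a. a \<le> 1 - \<epsilon>"] by blast
  then have "(S l *\<^sub>v (C l * T l *\<^sub>v (steady_map *\<^sub>v x))) $ i \<le> 1 - \<epsilon>"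
    using l i S[OF l] by auto
  moreover have "S l * (C l * T l) * steady_map *\<^sub>v x = S l *\<^sub>v (C l * T l *\<^sub>v (steady_map *\<^sub>v x))"
    using assoc_mult_mat_vec[OF mult_carrier_mat[OF S[OF l] mult_carrier_mat[OF C transition_carrier]]
        steady_map_carrier x_carrier]
      assoc_mult_mat_vec[OF S[OF l] mult_carrier_mat[OF C transition_carrier] Ex] by simp
  ultimately show ?thesis by simp
qed

text \<open>The rows of the matrices \<open>C l * T l * \<Phi>\<^sup>i\<close> with \<open>i < m\<close> are the rows of \<open>L * \<Phi>\<^sup>i\<close>. By observability
  they are functionals with only the common zero \<open>0\<close>, so their values bound the state.\<close>

lemma observable_state_bound:
  assumes obs: "observable_pair L \<Phi>"
  obtains m K where "\<And>z B a. z \<in> carrier_vec n \<Longrightarrow>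
      (\<And>i l j. i < m \<Longrightarrow> l < N \<Longrightarrow> j < p \<Longrightarrow> \<bar>(C l * T l * \<Phi> ^\<^sub>m i *\<^sub>v z) $ j\<bar> \<le> B) \<Longrightarrow>
      B \<ge> 0 \<Longrightarrow> a < n \<Longrightarrow> \<bar>z $ a\<bar> \<le> K * B"
proof -
  obtain m where m: "\<And>z z'. z \<in> carrier_vec n \<Longrightarrow> z' \<in> carrier_vec n \<Longrightarrow>
      (\<And>i. i < m \<Longrightarrow> L *\<^sub>v (\<Phi> ^\<^sub>m i *\<^sub>v z) = L *\<^sub>v (\<Phi> ^\<^sub>m i *\<^sub>v z')) \<Longrightarrow> z = z'"
    using obs carrier_matD[OF Phi_carrier] unfolding observable_pair_def by metis
  let ?M = "\<lambda>i l. C l * T l * \<Phi> ^\<^sub>m i"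
  let ?I = "{..<m} \<times> {..<N} \<times> {..<p}"
  define u where "u = (\<lambda>(i,l,j). row (?M i l) j)"
  have Mc: "?M i l \<in> carrier_mat p n" for i l
    by (intro mult_carrier_mat[of _ p n] C transition_carrier pow_carrier_mat Phi_carrier)
  have u_apply: "u (i,l,j) \<bullet> z = (?M i l *\<^sub>v z) $ j" if "j < p" for i l j z
    using that carrier_matD[OF Mc] by (simp add: u_def)
  have sep: "z = 0\<^sub>v n" if z: "z \<in> carrier_vec n" and 0: "\<And>t. t \<in> ?I \<Longrightarrow> u t \<bullet> z = 0" for z
  proof (rule m[OF z zero_carrier_vec])
    fix i assume i: "i < m"
    have Pi: "\<Phi> ^\<^sub>m i \<in> carrier_mat n n" by simp
    have "C l * T l *\<^sub>v (\<Phi> ^\<^sub>m i *\<^sub>v z) = C l * T l *\<^sub>v (\<Phi> ^\<^sub>m i *\<^sub>v 0\<^sub>v n)" if l: "l < N" for l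
    proof -
      have eq: "C l * T l *\<^sub>v (\<Phi> ^\<^sub>m i *\<^sub>v y) = ?M i l *\<^sub>v y" if "y \<in> carrier_vec n" for y
        using assoc_mult_mat_vec[OF mult_carrier_mat[OF C transition_carrier] Pi that] by simp
      have "?M i l *\<^sub>v z = 0\<^sub>v p"
      proof (rule eq_vecI)
        fix j assume "j < dim_vec (0\<^sub>v p)"
        then show "(?M i l *\<^sub>v z) $ j = 0\<^sub>v p $ j"
          using 0[of "(i,l,j)"] i l u_apply[of j i l z] by simp
      qed (use carrier_matD[OF Mc] in simp)
      moreover have "?M i l *\<^sub>v 0\<^sub>v n = 0\<^sub>v p"
        by (rule mult_mat_vec_zero[OF Mc])
      ultimately show ?thesis by (simp only: eq[OF z] eq[OF zero_carrier_vec])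
    qed
    then show "L *\<^sub>v (\<Phi> ^\<^sub>m i *\<^sub>v z) = L *\<^sub>v (\<Phi> ^\<^sub>m i *\<^sub>v 0\<^sub>v n)"
      using lifted_C_mult_vec[OF mult_mat_vec_carrier[OF Pi z]]
        lifted_C_mult_vec[OF mult_mat_vec_carrier[OF Pi zero_carrier_vec]]
      by (auto intro!: arg_cong[where f = concat_vecs])
  qed
  have row_in: "u (i,l,j) \<in> carrier_vec n" if "j < p" for i l j
    unfolding u_def prod.case by (rule row_carrier_vec[OF that Mc])
  have u_carrier: "u t \<in> carrier_vec n" if "t \<in> ?I" for t
    using that by (auto intro: row_in)
  obtain K where K: "\<And>z B a. z \<in> carrier_vec n \<Longrightarrow> (\<And>t. t \<in> ?I \<Longrightarrow> \<bar>u t \<bullet> z\<bar> \<le> B) \<Longrightarrow>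
      B \<ge> 0 \<Longrightarrow> a < n \<Longrightarrow> \<bar>z $ a\<bar> \<le> K * B"
    using separating_functionals_bound[of ?I u n, OF _ u_carrier sep] by blast
  show ?thesis
  proof (rule that[of m K])
    fix z B a
    assume z: "z \<in> carrier_vec n" and "B \<ge> (0::real)" "a < n"
      and bd: "\<And>i l j. i < m \<Longrightarrow> l < N \<Longrightarrow> j < p \<Longrightarrow> \<bar>(C l * T l * \<Phi> ^\<^sub>m i *\<^sub>v z) $ j\<bar> \<le> B"
    then show "\<bar>z $ a\<bar> \<le> K * B"
      by (intro K) (auto simp: u_apply simp del: index_mult_mat_vec)
  qed
qed

section \<open>Finite determination\<close>

text \<open>The horizon \<open>j0\<close> covers \<open>m\<close> periods after time \<open>N\<close>, so that the constraints up to \<open>j0\<close> bound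
  the state at time \<open>N\<close>, and \<open>R\<close> periods, so that afterwards the entries of \<open>S l\<close> times the output exceed their
  limits by at most \<open>\<epsilon>\<close>.\<close>

theorem finitely_determined_if_observable:
  assumes S: "\<And>k. k < N \<Longrightarrow> S k \<in> carrier_mat (q k) p"
    and obs: "observable_pair L \<Phi>"
    and compact: "\<And>k. k < N \<Longrightarrow> compact_vecs p (output_set p S k)"
    and \<epsilon>: "\<epsilon> > 0" and k: "k < N"
  shows "finitely_determined N n p d A C S \<epsilon> k"
proof -
  obtain m K where K: "\<And>z B a. z \<in> carrier_vec n \<Longrightarrow>
      (\<And>i l j. i < m \<Longrightarrow> l < N \<Longrightarrow> j < p \<Longrightarrow> \<bar>(C l * T l * \<Phi> ^\<^sub>m i *\<^sub>v z) $ j\<bar> \<le> B) \<Longrightarrow>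
      B \<ge> 0 \<Longrightarrow> a < n \<Longrightarrow> \<bar>z $ a\<bar> \<le> K * B"
    using observable_state_bound[OF obs] by metis
  have "\<exists>b. \<forall>y\<in>output_set p S l. \<forall>j<p. \<bar>y $ j\<bar> \<le> b" if "l < N" for l
    using compact_vecs_bounded[OF compact[OF that]] by metis
  then obtain b where b: "\<And>l y j. l < N \<Longrightarrow> y \<in> output_set p S l \<Longrightarrow> j < p \<Longrightarrow> \<bar>y $ j\<bar> \<le> b l"
    by metis
  define B where "B = (\<Sum>l<N. \<bar>b l\<bar>)"
  have B0: "B \<ge> 0" by (simp add: B_def sum_nonneg)
  have B: "\<bar>y $ j\<bar> \<le> B" if "l < N" "y \<in> output_set p S l" "j < p" for l y j
  proof -
    have "\<bar>y $ j\<bar> \<le> \<bar>b l\<bar>" using b[OF that] by simp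
    also have "\<dots> \<le> B" unfolding B_def by (rule member_le_sum) (use that in auto)
    finally show ?thesis .
  qed
  let ?Q = "\<lambda>l. S l * (C l * T l)"
  have Q: "?Q l \<in> carrier_mat (q l) n" if "l < N" for l
    by (rule mult_carrier_mat[OF S[OF that] mult_carrier_mat[OF C transition_carrier]])
  have "eventually (\<lambda>r. \<forall>l\<in>{..<N}. \<forall>w\<in>carrier_vec n. (\<forall>j<n. \<bar>w $ j\<bar> \<le> K * B) \<longrightarrow>
           (\<forall>i<q l. (?Q l * \<Phi> ^\<^sub>m r *\<^sub>v w) $ i \<le> (?Q l * steady_map *\<^sub>v w) $ i + \<epsilon>)) sequentially"
  proof (rule eventually_ball_finite[OF finite_lessThan], rule ballI)
    fix l assume "l \<in> {..<N}"
    then have Ql: "?Q l \<in> carrier_mat (q l) n" using Q by simp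
    show "eventually (\<lambda>r. \<forall>w\<in>carrier_vec n. (\<forall>j<n. \<bar>w $ j\<bar> \<le> K * B) \<longrightarrow>
           (\<forall>i<q l. (?Q l * \<Phi> ^\<^sub>m r *\<^sub>v w) $ i \<le> (?Q l * steady_map *\<^sub>v w) $ i + \<epsilon>)) sequentially"
      by (intro mat_tendsto_uniform_on_bounded mat_tendsto_mult_left[OF Ql _ _ Phi_power_tendsto]
          mult_carrier_mat[OF Ql] \<epsilon> pow_carrier_mat Phi_carrier steady_map_carrier)
  qed
  then obtain R where R: "\<And>r l w i. r \<ge> R \<Longrightarrow> l < N \<Longrightarrow> w \<in> carrier_vec n \<Longrightarrow>
      (\<And>j. j < n \<Longrightarrow> \<bar>w $ j\<bar> \<le> K * B) \<Longrightarrow> i < q l \<Longrightarrow>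
      (?Q l * \<Phi> ^\<^sub>m r *\<^sub>v w) $ i \<le> (?Q l * steady_map *\<^sub>v w) $ i + \<epsilon>"
    unfolding eventually_sequentially by (metis lessThan_iff)
  define j0 where "j0 = N + N * (m + R)"
  have step: "C t *\<^sub>v solution A k x (t - k) \<in> output_set p S (t mod N)"
    if x_ss: "x \<in> Omega_ss N n d A C S \<epsilon>" and x_upto: "x \<in> Omega_upto N n p A C S k j0" and t: "k \<le> t" for x t
  proof (cases "t \<le> j0")
    case True
    then show ?thesis using x_upto t by (simp add: Omega_upto_def)
  next
    case False
    have x: "x \<in> carrier_vec n" using x_ss by (simp add: Omega_ss_def)
    define w where "w = solution A k x (N - k)"
    have w: "w \<in> carrier_vec n" unfolding w_def by (rule solution_carrier[OF x])
    \<comment> \<open>The state at time \<open>N\<close> is bounded rather than \<open>x\<close> itself: the observability hypothesis is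
      about phase \<open>0\<close>, and a singular \<open>A t\<close> may hide part of \<open>x\<close> from the outputs after time \<open>N\<close>.\<close>
    have w_bound: "\<bar>w $ a\<bar> \<le> K * B" if "a < n" for a
    proof (rule K[OF w _ B0 that])
      fix i l j assume i: "i < m" and l: "l < N" and j: "j < p"
      let ?t = "N + N * i + l"
      have "N * i + l \<le> N * m"
        using i l mult_le_mono2[of "Suc i" m N] by simp
      then have "?t \<le> j0" by (simp add: j0_def algebra_simps)
      moreover have "k \<le> ?t" "?t mod N = l" using k phase_mod[OF l] by simp_all
      ultimately have "C ?t *\<^sub>v solution A k x (?t - k) \<in> output_set p S l"
        using x_upto by (force simp: Omega_upto_def)
      then show "\<bar>(C l * T l * \<Phi> ^\<^sub>m i *\<^sub>v w) $ j\<bar> \<le> B"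
        unfolding output_after_first_period[OF x k] w_def using l j by (intro B)
    qed
    define r l where "r = (t - N) div N" and "l = t mod N"
    have l: "l < N" using N by (simp add: l_def)
    have tN: "t \<ge> N" using False by (simp add: j0_def)
    then have "t = N + N * r + l"
      unfolding r_def l_def by (metis add.assoc le_add_diff_inverse mod_add_self1 mult_div_mod_eq)
    have "N * R \<le> t - N" using False by (simp add: j0_def algebra_simps)
    then have r: "R \<le> r"
      unfolding r_def using N by (simp add: less_eq_div_iff_mult_less_eq mult.commute)
    have P: "\<Phi> ^\<^sub>m r \<in> carrier_mat n n" by simp
    have CT: "C l * T l \<in> carrier_mat p n" by (rule mult_carrier_mat[OF C transition_carrier])
    let ?y = "C l * T l * \<Phi> ^\<^sub>m r *\<^sub>v w"
    have y: "?y \<in> carrier_vec p"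
      by (rule mult_mat_vec_carrier[OF mult_carrier_mat[OF CT P] w])
    have "(S l *\<^sub>v ?y) $ i \<le> 1" if i: "i < q l" for i
    proof -
      have "S l *\<^sub>v ?y = ?Q l * \<Phi> ^\<^sub>m r *\<^sub>v w"
        using assoc_mult_mat_vec[OF S[OF l] mult_carrier_mat[OF CT P] w]
          assoc_mult_mat[OF S[OF l] CT P] by simp
      also have "\<dots> $ i \<le> (?Q l * steady_map *\<^sub>v w) $ i + \<epsilon>"
        by (rule R[OF r l w w_bound i])
      also have "?Q l * steady_map *\<^sub>v w = ?Q l * steady_map *\<^sub>v x"
        using assoc_mult_mat_vec[OF Q[OF l] steady_map_carrier w] assoc_mult_mat_vec[OF Q[OF l] steady_map_carrier x]
          steady_map_solution[OF x] by (simp add: w_def)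
      also have "\<dots> $ i \<le> 1 - \<epsilon>"
        by (rule Omega_ss_steady_output[OF S x_ss l i])
      finally show ?thesis by simp
    qed
    then have "?y \<in> output_set p S l"
      using y S[OF l] by (auto simp: output_set_def less_eq_vec_def ones_vec_def)
    then show ?thesis
      unfolding \<open>t = N + N * r + l\<close> output_after_first_period[OF x k] w_def[symmetric]
      using l by (simp only: phase_mod)
  qed
  have "k \<le> j0" using k by (simp add: j0_def)
  have decreasing: "Omega_upto N n p A C S k j \<subseteq> Omega_upto N n p A C S k j0" if "j \<ge> j0" for j
    using that unfolding Omega_upto_def by fastforce
  have persistent: "x \<in> Omega_upto N n p A C S k j"
    if "x \<in> Omega_ss N n d A C S \<epsilon>" "x \<in> Omega_upto N n p A C S k j0" for x j
  proof -
    have "x \<in> carrier_vec n" using that(2) by (simp only: Omega_upto_def mem_Collect_eq)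
    then show ?thesis using step[OF that] by (simp only: Omega_upto_def mem_Collect_eq) blast
  qed
  have stab: "Omega_ss N n d A C S \<epsilon> \<inter> Omega_upto N n p A C S k j
      = Omega_ss N n d A C S \<epsilon> \<inter> Omega_upto N n p A C S k j0" if "j \<ge> j0" for j
    using decreasing[OF that] persistent by blast
  have "Omega_eps N n p d A C S \<epsilon> k = Omega_ss N n d A C S \<epsilon> \<inter> Omega_upto N n p A C S k j0"
    unfolding Omega_eps_def Omega_def using persistent \<open>k \<le> j0\<close> by blast
  with stab \<open>k \<le> j0\<close> show ?thesis unfolding finitely_determined_def by blast
qed

end

theorem theorem2:
  fixes N n p d :: nat
    and q :: "nat \<Rightarrow> nat"
    and A C S :: "nat \<Rightarrow> real mat"
  assumes "N \<ge> 1"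
    and "\<And>t. A t \<in> carrier_mat n n" and "\<And>t. C t \<in> carrier_mat p n"
    and "\<And>t. A (t + N) = A t" and "\<And>t. C (t + N) = C t"
    and "\<And>k. k < N \<Longrightarrow> S k \<in> carrier_mat (q k) p"
    and A1: "d \<le> n"
      "\<And>k. k < N \<Longrightarrow> \<exists>As \<in> carrier_mat (n - d) (n - d). \<exists>Ac \<in> carrier_mat (n - d) d.
         A k = four_block_mat As Ac (0\<^sub>m d (n - d)) (1\<^sub>m d)"
    and A2: "\<And>z. eigenvalue (map_mat complex_of_real (Phi_s N n d A)) z \<Longrightarrow> cmod z < 1"
    and A3: "observable_pair (lifted_C N n A C) (Phi N n A)"
    and A4: "\<And>k. k < N \<Longrightarrow> compact_vecs p (output_set p S k)"
  shows "\<forall>\<epsilon>::real. 0 < \<epsilon> \<and> \<epsilon> < 1 \<longrightarrow> (\<forall>k<N. finitely_determined N n p d A C S \<epsilon> k)"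
proof (intro allI impI)
  fix \<epsilon> :: real and k
  assume \<epsilon>: "0 < \<epsilon> \<and> \<epsilon> < 1" and k: "k < N"
  interpret periodic_system N n p d A C
    by (rule periodic_system.intro) (fact assms)+
  show "finitely_determined N n p d A C S \<epsilon> k"
    by (rule finitely_determined_if_observable[of S q, OF _ A3 A4 _ k]) (use assms(6) \<epsilon> in auto)
qed

end
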